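(* The formal power series \[ P(z,q)=\sum_{p}q^{\operatorname{queries}(p)}\frac{z^{|p|}}{|p|!}, \] where the sum ranges over all set partitions $p$ of $\{1,\dots,n\}$ for all $n\ge0$, $|p|=n$ is the size of the underlying set, and $\operatorname{queries}(p)$ is the number of queries used by the universal AC algorithm to recover $p$, is characterized by the differential equation $\partial_z P(z,q)=P(qz,q)\,e^{qz}$ together with the initial condition $P(0,q)=1$.
   Context: The universal AC algorithm recovers an unknown set partition of a finite labelled set by queries to an oracle answering whether two items are in the same block: if the set is empty it returns the empty partition; otherwise it takes the item $u$ of largest label, compares it with every other remaining item (one query each), forms the block of $u$ from the positively answered items, removes this block, recursively partitions the remaining items, and adds the block to the result. *)

theory Defs
  imports "HOL-Library.Disjoint_Sets" "HOL-Computational_Algebra.Formal_Power_Series"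
begin

definition same_block :: "'b set set \<Rightarrow> 'b \<Rightarrow> 'b \<Rightarrow> bool" where
  "same_block p u v \<longleftrightarrow> (\<exists>B\<in>p. u \<in> B \<and> v \<in> B)"

text \<open>
  The algorithm only sees the unknown partition through the oracle. Besides the
  reconstructed partition it returns the number of oracle calls: one for each item
  \<open>v\<close> of \<open>A - {u}\<close>. The value on infinite sets is a dummy that makes the function total.
\<close>

function ac_run :: "('b::linorder \<Rightarrow> 'b \<Rightarrow> bool) \<Rightarrow> 'b set \<Rightarrow> 'b set set \<times> nat" where
  "ac_run orc A =
     (if A = {} \<or> infinite A then ({}, 0)
      else let u = Max A;
               others = A - {u};
               B = insert u {v \<in> others. orc u v};
               (Q, c) = ac_run orc (A - B)
           in (insert B Q, card others + c))"
  by pat_completeness auto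
termination
proof (relation "measure (\<lambda>(orc, A). card A)", goal_cases)
  case 1
  show ?case by simp
next
  case (2 orc A u others B)
  have "finite A" "u \<in> A" "u \<in> B"
    using 2(1) Max_in[of A] unfolding 2(2) 2(4) by blast+
  then have "card (A - B) < card A"
    by (intro psubset_card_mono) blast+
  then show ?case
    by simp
qed

declare ac_run.simps [simp del]

definition queries :: "'b::linorder set set \<Rightarrow> nat" where
  "queries p = snd (ac_run (same_block p) (\<Union>p))"

lemma ac_run_correct:
  assumes "partition_on A p" "finite A"
  shows "fst (ac_run (same_block p) A) = p"
proof -
  have "fst (ac_run (same_block p) S) = r"
    if "finite S" "partition_on S r" "r \<subseteq> p" for S r
    using that
  proof (induction "card S" arbitrary: S r rule: less_induct)
    case less
    show ?case
    proof (cases "S = {}")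
      case True
      with less.prems show ?thesis
        by (simp add: ac_run.simps partition_on_empty)
    next
      case False
      define u where "u = Max S"
      have u: "u \<in> S" using False less.prems unfolding u_def by simp
      then obtain B where B: "B \<in> r" "u \<in> B"
        using less.prems(2) by (auto simp: partition_on_def)
      have BS: "B \<subseteq> S" using B less.prems(2) by (auto simp: partition_on_def)
      have uniq: "C = B" if "C \<in> p" "u \<in> C" for C
        using that B less.prems(3) disjointD[OF partition_onD2[OF assms(1)], of C B] by blast
      have Beq: "insert u {v \<in> S - {u}. same_block p u v} = B"
      proof (intro equalityI subsetI)
        fix v assume "v \<in> insert u {v \<in> S - {u}. same_block p u v}"
        then show "v \<in> B" using uniq B(2) by (auto simp: same_block_def)
      next
        fix v assume "v \<in> B"
        then show "v \<in> insert u {v \<in> S - {u}. same_block p u v}"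
          using B BS less.prems(3) by (auto simp: same_block_def)
      qed
      have disj: "B \<inter> C = {}" if "C \<in> r" "C \<noteq> B" for C
        using disjointD[OF partition_onD2[OF less.prems(2)], of B C] that B(1) by blast
      have part: "partition_on (S - B) (r - {B})"
      proof (rule partition_onI)
        show "\<Union>(r - {B}) = S - B"
          using partition_onD1[OF less.prems(2)] disj by blast
        show "disjnt C D" if "C \<in> r - {B}" "D \<in> r - {B}" "C \<noteq> D" for C D
          using disjointD[OF partition_onD2[OF less.prems(2)], of C D] that
          by (simp add: disjnt_def)
        show "{} \<notin> r - {B}"
          using partition_onD3[OF less.prems(2)] by blast
      qed
      have lt: "card (S - B) < card S"
        using less.prems(1) u B(2) by (intro psubset_card_mono) blast+
      have IH: "fst (ac_run (same_block p) (S - B)) = r - {B}"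
      proof (rule less.hyps[OF lt])
        show "finite (S - B)" using less.prems(1) by simp
        show "r - {B} \<subseteq> p" using less.prems(3) by blast
      qed (rule part)
      have "fst (ac_run (same_block p) S) = insert B (fst (ac_run (same_block p) (S - B)))"
        using False less.prems(1) Beq
        unfolding u_def ac_run.simps[of _ S] by (simp add: Let_def case_prod_beta)
      with IH B(1) show ?thesis by (simp add: insert_absorb)
    qed
  qed
  from this[OF assms(2,1)] show ?thesis by simp
qed

text \<open>
  A bivariate series in \<open>z\<close> and \<open>q\<close> is a series in \<open>z\<close> whose coefficients are series in
  \<open>q\<close>: the outer \<open>fps_X\<close> is \<open>z\<close> and \<open>fps_const fps_X\<close> is \<open>q\<close>. The sum over all set
  partitions is collected by the size \<open>n\<close> of the underlying set, giving finitely many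
  terms for each power of \<open>z\<close>.
\<close>

definition ac_gf :: "'a::field_char_0 fps fps" where
  "ac_gf = Abs_fps (\<lambda>n. \<Sum>p | partition_on {1..n} p. fps_X ^ queries p * fps_const (1 / fact n))"

definition qz :: "'a::field_char_0 fps fps" where
  "qz = fps_const fps_X * fps_X"

text \<open>
  The series \<open>fps_exp\<close> requires coefficients in a field, so it is formed over \<open>'a\<close> and its
  coefficients are then embedded as constant series in \<open>q\<close>.
\<close>

definition exp_z :: "'a::field_char_0 fps fps" where
  "exp_z = Abs_fps (\<lambda>n. fps_const (fps_nth (fps_exp 1) n))"

end

theory Submission
  imports Defs
begin

text \<open>
  Recovering a partition of \<open>A\<close>, with \<open>card A = n + 1\<close>, costs \<open>n\<close> queries for the block of the
  largest item, plus the cost of the induced partition of the remaining set, which can be any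
  subset of the other \<open>n\<close> items. Hence the cost enumerator depends only on \<open>card A\<close> and satisfies
  \<open>t (n + 1) = q ^ n * (\<Sum>k\<le>n. (n choose k) * t k)\<close>. After division by \<open>fact n\<close> this is the
  coefficient of \<open>z ^ n\<close> in the differential equation, and it determines all coefficients.
\<close>

text \<open>All queries of a run on \<open>A\<close> concern two items of \<open>A\<close>. This
  lets the oracle of the whole partition be exchanged for that of the induced partition once the
  first block is removed.\<close>

lemma ac_run_cong:
  assumes "\<And>u v. u \<in> A \<Longrightarrow> v \<in> A \<Longrightarrow> orc u v \<longleftrightarrow> orc' u v"
  shows "ac_run orc A = ac_run orc' A"
  using assms
proof (induction "card A" arbitrary: A rule: less_induct)
  case less
  show ?case
  proof (cases "A = {} \<or> infinite A")
    case True
    then show ?thesis by (simp add: ac_run.simps)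
  next
    case False
    define B where "B = insert (Max A) {v \<in> A - {Max A}. orc (Max A) v}"
    have u: "Max A \<in> A" using False by simp
    have B': "B = insert (Max A) {v \<in> A - {Max A}. orc' (Max A) v}"
      unfolding B_def using less.prems[OF u] by auto
    have "card (A - B) < card A"
      using False u unfolding B_def by (intro psubset_card_mono) blast+
    then have "ac_run orc (A - B) = ac_run orc' (A - B)"
      by (rule less.hyps) (simp add: less.prems)
    then show ?thesis
      unfolding ac_run.simps[of _ A] Let_def B_def[symmetric] B'[symmetric] by simp
  qed
qed

text \<open>Splitting off the block of \<open>u\<close> is reversible. The block is recorded by its
  complement \<open>S\<close>, the set on which the algorithm recurses.\<close>

lemma bij_betw_partition_on_remove_block:
  assumes "u \<in> A"
  shows "bij_betw (\<lambda>(S, r). insert (A - S) r)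
           (SIGMA S:Pow (A - {u}). {r. partition_on S r}) {p. partition_on A p}"
proof (rule bij_betwI')
  fix x y
  assume x: "x \<in> (SIGMA S:Pow (A - {u}). {r. partition_on S r})"
    and y: "y \<in> (SIGMA S:Pow (A - {u}). {r. partition_on S r})"
  obtain S r S' r' where xy: "x = (S, r)" "y = (S', r')" by fastforce
  have S: "S \<subseteq> A - {u}" "\<Union>r = S" "S' \<subseteq> A - {u}" "\<Union>r' = S'"
    using x y by (auto simp: xy partition_on_def)
  \<comment> \<open>Each inserted block contains \<open>u\<close>, while the members of
    \<open>r\<close> and \<open>r'\<close> lie in sets avoiding \<open>u\<close>; so the inserted
    block can be read off from the image.\<close>
  have nin: "A - S \<notin> r" "A - S \<notin> r'" "A - S' \<notin> r'"
    using S assms by blast+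
  have "S = S' \<and> r = r'" if eq: "insert (A - S) r = insert (A - S') r'"
  proof -
    have "A - S = A - S'" using eq nin by blast
    moreover from this have "r = r'" using eq nin by (metis insert_ident)
    ultimately show ?thesis using S by blast
  qed
  then show "((case x of (S, r) \<Rightarrow> insert (A - S) r) = (case y of (S, r) \<Rightarrow> insert (A - S) r))
      \<longleftrightarrow> x = y"
    by (auto simp: xy)
next
  fix x
  assume x: "x \<in> (SIGMA S:Pow (A - {u}). {r. partition_on S r})"
  obtain S r where xy: "x = (S, r)" by fastforce
  have S: "S \<subseteq> A - {u}" "partition_on S r" "\<Union>r = S"
    using x by (auto simp: xy partition_on_def)
  have "A - (A - S) = S" using S by blast
  moreover have "disjnt (A - S) (\<Union>r)" using S by (auto simp: disjnt_def)
  moreover have "A - S \<noteq> {}" using S assms by blast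
  ultimately have "partition_on A (insert (A - S) r)"
    using S(2) by (simp add: partition_on_insert)
  then show "(case x of (S, r) \<Rightarrow> insert (A - S) r) \<in> {p. partition_on A p}"
    by (simp add: xy)
next
  fix p
  assume "p \<in> {p. partition_on A p}"
  then have p: "partition_on A p" by simp
  then obtain B where B: "B \<in> p" "u \<in> B" "B \<subseteq> A"
    using assms by (auto simp: partition_on_def)
  have ins: "insert B (p - {B}) = p" using B by blast
  have "disjnt B (\<Union>(p - {B}))"
    using disjointD[OF partition_onD2[OF p], of B] B by (fastforce simp: disjnt_def)
  then have "partition_on (A - B) (p - {B})"
    using partition_on_insert[of B "p - {B}" A] p ins by simp
  moreover have "A - (A - B) = B" using B by blast
  ultimately show "\<exists>x\<in>(SIGMA S:Pow (A - {u}). {r. partition_on S r}).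
      p = (case x of (S, r) \<Rightarrow> insert (A - S) r)"
    using B ins by (intro bexI[of _ "(A - B, p - {B})"]) auto
qed

text \<open>The first round compares \<open>Max A\<close> with all other items, finds the block
  \<open>A - S\<close>, and leaves \<open>S\<close>.\<close>

lemma snd_ac_run_insert_block:
  fixes A :: "'b::linorder set"
  assumes "finite A" "A \<noteq> {}" and S: "S \<subseteq> A - {Max A}" and r: "partition_on S r"
  shows "snd (ac_run (same_block (insert (A - S) r)) A)
    = card (A - {Max A}) + snd (ac_run (same_block r) S)"
proof -
  let ?o = "same_block (insert (A - S) r)"
  have u: "Max A \<in> A" using assms by simp
  have Ur: "\<Union>r = S" using r by (simp add: partition_on_def)
  have B: "insert (Max A) {v \<in> A - {Max A}. ?o (Max A) v} = A - S"
    using S Ur u by (auto simp: same_block_def)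
  have AS: "A - (A - S) = S" using S by blast
  \<comment> \<open>The additional block \<open>A - S\<close> contains no item of \<open>S\<close>,
    so it cannot change an answer there.\<close>
  have "ac_run ?o S = ac_run (same_block r) S"
    by (rule ac_run_cong) (auto simp: same_block_def)
  then show ?thesis
    using assms(1,2) unfolding ac_run.simps[of _ A] Let_def B AS by (simp add: case_prod_beta)
qed

lemma sum_Pow_card:
  fixes f :: "nat \<Rightarrow> 'c::comm_semiring_1"
  assumes "finite A"
  shows "(\<Sum>S\<in>Pow A. f (card S)) = (\<Sum>k\<le>card A. of_nat (card A choose k) * f k)"
proof -
  have "(\<Sum>S\<in>Pow A. f (card S))
      = (\<Sum>k\<le>card A. \<Sum>S\<in>{S \<in> Pow A. card S = k}. f (card S))"
    using assms by (intro sum.group[symmetric]) (auto intro: card_mono)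
  also have "\<dots> = (\<Sum>k\<le>card A. of_nat (card A choose k) * f k)"
    using n_subsets[OF assms] by (intro sum.cong) auto
  finally show ?thesis .
qed

text \<open>The enumerator \<open>t\<close> of the recursion above; here \<open>fps_X\<close> is the
  variable q.\<close>

fun query_poly :: "nat \<Rightarrow> 'a::comm_semiring_1 fps" where
  "query_poly 0 = 1"
| "query_poly (Suc n) = fps_X ^ n * (\<Sum>k\<le>n. of_nat (n choose k) * query_poly k)"

text \<open>The set must be arbitrary for the induction: what remains of \<open>{1..n}\<close> after
  a round need not be an initial interval.\<close>

lemma sum_snd_ac_run:
  fixes A :: "'b::linorder set"
  assumes "finite A"
  shows "(\<Sum>p | partition_on A p. fps_X ^ snd (ac_run (same_block p) A))
    = (query_poly (card A) :: 'a::comm_semiring_1 fps)"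
  using assms
proof (induction "card A" arbitrary: A rule: less_induct)
  case less
  show ?case
  proof (cases "A = {}")
    case True
    moreover have "{p. partition_on {} p} = {{} :: 'b set set}"
      by (auto simp: partition_on_empty)
    ultimately show ?thesis
      by (simp add: ac_run.simps)
  next
    case False
    let ?A' = "A - {Max A}"
    have u: "Max A \<in> A" using False less.prems by simp
    have card: "card A = Suc (card ?A')"
      using card.remove[OF less.prems u] .
    have "(\<Sum>p | partition_on A p. fps_X ^ snd (ac_run (same_block p) A))
      = (\<Sum>(S, r)\<in>(SIGMA S:Pow ?A'. {r. partition_on S r}).
          fps_X ^ snd (ac_run (same_block (insert (A - S) r)) A) :: 'a fps)"
      by (subst sum.reindex_bij_betw[OF bij_betw_partition_on_remove_block[OF u], symmetric])
        (simp add: case_prod_unfold)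
    also have "\<dots> = (\<Sum>(S, r)\<in>(SIGMA S:Pow ?A'. {r. partition_on S r}).
          fps_X ^ card ?A' * fps_X ^ snd (ac_run (same_block r) S))"
      by (intro sum.cong refl)
        (clarsimp simp: snd_ac_run_insert_block[OF less.prems False] power_add)
    also have "\<dots> = (\<Sum>S\<in>Pow ?A'. \<Sum>r | partition_on S r.
          fps_X ^ card ?A' * fps_X ^ snd (ac_run (same_block r) S))"
      using less.prems
      by (subst sum.Sigma) (auto intro: finitely_many_partition_on finite_subset)
    also have "\<dots> = (\<Sum>S\<in>Pow ?A'. fps_X ^ card ?A' * query_poly (card S))"
    proof (intro sum.cong refl)
      fix S assume S: "S \<in> Pow ?A'"
      then have "card S < card A"
        using u less.prems by (intro psubset_card_mono) auto
      moreover have "finite S" using S less.prems by (auto intro: finite_subset)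
      ultimately have "(\<Sum>r | partition_on S r. fps_X ^ snd (ac_run (same_block r) S))
          = (query_poly (card S) :: 'a fps)"
        by (intro less.hyps)
      then show "(\<Sum>r | partition_on S r.
            fps_X ^ card ?A' * fps_X ^ snd (ac_run (same_block r) S))
          = fps_X ^ card ?A' * (query_poly (card S) :: 'a fps)"
        by (simp flip: sum_distrib_left)
    qed
    also have "\<dots> = query_poly (card A)"
      unfolding card query_poly.simps sum_distrib_left[symmetric]
      using less.prems by (subst sum_Pow_card) simp_all
    finally show ?thesis .
  qed
qed

lemma ac_gf_nth: "fps_nth ac_gf n = query_poly n * fps_const (1 / fact n)"
proof -
  have "queries p = snd (ac_run (same_block p) {1..n})" if "partition_on {1..n} p" for p
    using partition_onD1[OF that] by (simp add: queries_def)
  then show ?thesis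
    using sum_snd_ac_run[of "{1..n}"]
    by (simp add: ac_gf_def flip: sum_distrib_right)
qed

lemma fps_compose_qz_nth: "fps_nth (F oo qz) n = fps_X ^ n * fps_nth F n"
  unfolding qz_def by (rule fps_nth_compose_linear)

text \<open>Substituting \<open>qz\<close> preserves degrees in z, so the coefficient of z^n
  involves only coefficients of \<open>F\<close> up to \<open>n\<close>. Bounding the hypothesis by
  \<open>n\<close> makes the lemma usable inside the uniqueness induction.\<close>

lemma ode_rhs_nth:
  fixes F :: "'a::field_char_0 fps fps"
  assumes "\<And>i. i \<le> n \<Longrightarrow> fps_nth F i = query_poly i * fps_const (1 / fact i)"
  shows "fps_nth ((F oo qz) * (exp_z oo qz)) n = query_poly (Suc n) * fps_const (1 / fact n)"
proof -
  have "fps_nth ((F oo qz) * (exp_z oo qz)) n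
    = (\<Sum>i\<le>n. (fps_X ^ i * fps_nth F i) * (fps_X ^ (n - i) * fps_const (1 / fact (n - i))))"
    by (simp add: fps_mult_nth fps_compose_qz_nth exp_z_def atLeast0AtMost)
  also have "\<dots> = (\<Sum>i\<le>n. fps_X ^ n * (of_nat (n choose i) * query_poly i)
      * fps_const (1 / fact n))"
  proof (intro sum.cong refl)
    fix i assume "i \<in> {..n}"
    then have i: "i \<le> n" by simp
    \<comment> \<open>The powers of q contributed by the two factors always combine to q^n,
      independently of \<open>i\<close>.\<close>
    have X: "fps_X ^ n = fps_X ^ i * (fps_X ^ (n - i) :: 'a fps)"
      using i by (simp flip: power_add)
    have "fps_const (1 / fact i) * fps_const (1 / fact (n - i))
        = of_nat (n choose i) * (fps_const (1 / fact n) :: 'a fps)"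
      using i by (simp add: binomial_fact flip: fps_of_nat)
    note const = this
    have "(fps_X ^ i * fps_nth F i) * (fps_X ^ (n - i) * fps_const (1 / fact (n - i)))
        = (fps_X ^ i * fps_X ^ (n - i)) * query_poly i
          * (fps_const (1 / fact i) * fps_const (1 / fact (n - i)))"
      unfolding assms[OF i] by (simp only: mult_ac)
    also have "\<dots> = fps_X ^ n * (of_nat (n choose i) * query_poly i) * fps_const (1 / fact n)"
      unfolding const X by (simp only: mult_ac)
    finally show "(fps_X ^ i * fps_nth F i) * (fps_X ^ (n - i) * fps_const (1 / fact (n - i)))
        = fps_X ^ n * (of_nat (n choose i) * query_poly i) * fps_const (1 / fact n)" .
  qed
  also have "\<dots> = query_poly (Suc n) * fps_const (1 / fact n)"
    by (simp add: sum_distrib_left sum_distrib_right)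
  finally show ?thesis .
qed

text \<open>Translates between a coefficient of the derivative and one of the series; the factor
  \<open>Suc n\<close> is nonzero in characteristic 0 and cancels.\<close>

lemma of_nat_mult_eq_divide_fact_iff:
  fixes a b :: "'a::field_char_0 fps"
  shows "of_nat (Suc n) * a = b * fps_const (1 / fact n)
    \<longleftrightarrow> a = b * fps_const (1 / fact (Suc n))"
proof -
  have c: "fps_const (1 / fact n) = of_nat (Suc n) * (fps_const (1 / fact (Suc n)) :: 'a fps)"
    by (simp del: of_nat_Suc flip: fps_of_nat)
  have "of_nat (Suc n) \<noteq> (0 :: 'a fps)"
    by (simp del: of_nat_Suc flip: fps_of_nat)
  then show ?thesis
    unfolding c by (simp only: mult.left_commute[of b] mult_cancel_left simp_thms)
qed

theorem theorem8:
  fixes F :: "'a::field_char_0 fps fps"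
  shows "(fps_deriv F = (F oo qz) * (exp_z oo qz) \<and> fps_nth F 0 = 1) \<longleftrightarrow> F = ac_gf"
proof
  assume F: "fps_deriv F = (F oo qz) * (exp_z oo qz) \<and> fps_nth F 0 = 1"
  \<comment> \<open>Uniqueness: the equation at z^m expresses coefficient \<open>Suc m\<close>
    through coefficients up to \<open>m\<close>, and the initial condition supplies coefficient
    0.\<close>
  have "fps_nth F n = query_poly n * fps_const (1 / fact n)" for n
  proof (induction n rule: less_induct)
    case (less n)
    show ?case
    proof (cases n)
      case 0
      with F show ?thesis by simp
    next
      case (Suc m)
      then have "fps_nth (fps_deriv F) m = query_poly (Suc m) * fps_const (1 / fact m)"
        using F by (simp only: ode_rhs_nth less.IH less_Suc_eq_le)
      then show ?thesis
        unfolding Suc fps_deriv_nth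
        by (simp only: of_nat_mult_eq_divide_fact_iff flip: Suc_eq_plus1)
    qed
  qed
  then show "F = ac_gf"
    by (simp add: fps_eq_iff[of F] ac_gf_nth)
next
  assume F: "F = ac_gf"
  \<comment> \<open>For \<open>ac_gf\<close> all coefficients are known, so both sides are computed
    explicitly.\<close>
  have "fps_nth (fps_deriv F) n = fps_nth ((F oo qz) * (exp_z oo qz)) n" for n
    unfolding ode_rhs_nth[of n F, unfolded F, OF ac_gf_nth] F fps_deriv_nth
    by (simp only: of_nat_mult_eq_divide_fact_iff ac_gf_nth flip: Suc_eq_plus1)
  then have "fps_deriv F = (F oo qz) * (exp_z oo qz)"
    by (rule fps_ext)
  then show "fps_deriv F = (F oo qz) * (exp_z oo qz) \<and> fps_nth F 0 = 1"
    by (simp add: F ac_gf_nth)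
qed

end
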